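(* For arbitrary $N$ samplers, with down-sampling rates denoted $M_1,\dots,M_N$, there exists a distributed co-prime sampling scheme (as described in the context) which can provide at least $$L\,\frac{1}{\pi^2}\,N(N-1)(N-2)$$ virtual samples to estimate $\mathbb{E}_l\{x_{i_1}[kb_{i_1}+la_{i_1}]\,x^*_{i_2}[-(kb_{i_2}+la_{i_2})]\,x_{i_3}[kb_{i_3}+la_{i_3}]\}$, with time delay upper bounded by $$2(N-1)(K+L)\,M\,T_s,\qquad M=\max_i\{M_i\}.$$ The result is understood in an asymptotic sense in $N$.
   Context: Signal model: $x(t)=\sum_{i=1}^{D}A_ie^{j(\omega_it+\phi_i)}$ is a complex waveform formed by $D$ sources with amplitudes $A_i$, digital frequencies $\omega_i$ and random phases $\phi_i$ (uniform on $[0,2\pi]$, uncorrelated from each other), and $T_s$ is the Nyquist sampling interval. Sampler $i$ has down-sampling rate $M_i$ (a positive integer) and collects $x_i[n]=x(nM_iT_s)+w_i(n)$, where $w_i$ is zero-mean white Gaussian noise; its $n$-th sample is taken at time $nM_iT_s$. $K$ is the number of consecutive lags ($k=1,\dots,K$) and $L$ the number of snapshots ($l=1,\dots,L$); $^*$ is complex conjugation and $\mathbb{E}_l$ denotes averaging over $l$. Distributed co-prime sampling scheme: one selects three-element subsets $\{i_1,i_2,i_3\}$ of $\{1,\dots,N\}$ for which there are integers $a_{i_1},a_{i_2},a_{i_3}$ and $b_{i_1},b_{i_2},b_{i_3}$ (depending on the subset; the signs of the $a$'s are not all the same, nor are those of the $b$'s) with $$a_{i_1}M_{i_1}+a_{i_2}M_{i_2}+a_{i_3}M_{i_3}=0,\quad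 a_{i_1}+a_{i_2}+a_{i_3}=0,$$ $$b_{i_1}M_{i_1}+b_{i_2}M_{i_2}+b_{i_3}M_{i_3}=1,\quad b_{i_1}+b_{i_2}+b_{i_3}=0,$$ and such that, for all $k\in\{1,\dots,K\}$ and $l\in\{1,\dots,L\}$, $kb_{i_1}+la_{i_1}$ and $kb_{i_3}+la_{i_3}$ are positive and $kb_{i_2}+la_{i_2}$ is negative. Then $(kb_{i_1}+la_{i_1})M_{i_1}+(kb_{i_2}+la_{i_2})M_{i_2}+(kb_{i_3}+la_{i_3})M_{i_3}=k$, and for each lag $k$ every selected subset contributes the $L$ virtual samples $x_{i_1}[kb_{i_1}+la_{i_1}]\,x^*_{i_2}[-(kb_{i_2}+la_{i_2})]\,x_{i_3}[kb_{i_3}+la_{i_3}]$, $l=1,\dots,L$. Time delay of the scheme: the time needed to collect all the samples used, i.e. the maximum over the selected subsets, over $i\in\{i_1,i_2,i_3\}$, $1\le k\le K$ and $1\le l\le L$ of $|kb_i+la_i|\,M_i\,T_s$.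
   Formalization: The down-sampling rates are chosen with the scheme (for each prescribed maximum M at least N), not given arbitrarily: if all rates are even, no admissible subset exists. The bound is proved exactly for all sufficiently large N. *)

theory Defs
  imports Complex_Main "HOL-Library.Multiset"
begin

text \<open>Samplers are numbered \<open>1, \<dots>, N\<close>; \<open>M i\<close> is the down-sampling rate of sampler \<open>i\<close>.\<close>

definition waveform ::
  "nat \<Rightarrow> (nat \<Rightarrow> real) \<Rightarrow> (nat \<Rightarrow> real) \<Rightarrow> (nat \<Rightarrow> real) \<Rightarrow> real \<Rightarrow> complex"
where
  "waveform D A \<omega> \<phi> t = (\<Sum>i\<in>{1..D}. of_real (A i) * exp (\<i> * of_real (\<omega> i * t + \<phi> i)))"

text \<open>The argument \<open>w\<close> is a realization of the noise: \<open>w i n\<close> is the noise in the \<open>n\<close>-th sample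
  of sampler \<open>i\<close>.\<close>

definition sampler_output ::
  "(real \<Rightarrow> complex) \<Rightarrow> (nat \<Rightarrow> int \<Rightarrow> complex) \<Rightarrow> (nat \<Rightarrow> nat) \<Rightarrow> real \<Rightarrow> nat \<Rightarrow> int \<Rightarrow> complex"
where
  "sampler_output x w M Ts i n = x (of_int n * real (M i) * Ts) + w i n"

text \<open>A scheme selects a family of subsets of the samplers. In a selected subset \<open>T\<close> the samplers
  \<open>fst_of S T\<close>, \<open>mid_of S T\<close>, \<open>trd_of S T\<close> play the roles of \<open>i\<^sub>1\<close>, \<open>i\<^sub>2\<close>, \<open>i\<^sub>3\<close>
  (\<open>i\<^sub>2\<close> is the conjugated factor), and \<open>acoef S T i\<close>, \<open>bcoef S T i\<close> are the coefficients of
  sampler \<open>i\<close>, which depend on \<open>T\<close>.\<close>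

record scheme =
  selected :: "nat set set"
  fst_of :: "nat set \<Rightarrow> nat"
  mid_of :: "nat set \<Rightarrow> nat"
  trd_of :: "nat set \<Rightarrow> nat"
  acoef :: "nat set \<Rightarrow> nat \<Rightarrow> int"
  bcoef :: "nat set \<Rightarrow> nat \<Rightarrow> int"

text \<open>Signed position \<open>k b\<^sub>i + l a\<^sub>i\<close>.\<close>

definition offset :: "scheme \<Rightarrow> nat set \<Rightarrow> nat \<Rightarrow> nat \<Rightarrow> nat \<Rightarrow> int" where
  "offset S T k l i = int k * bcoef S T i + int l * acoef S T i"

definition coprime_scheme :: "nat \<Rightarrow> (nat \<Rightarrow> nat) \<Rightarrow> nat \<Rightarrow> nat \<Rightarrow> scheme \<Rightarrow> bool" where
  "coprime_scheme N M K L S \<longleftrightarrow>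
    (\<forall>T\<in>selected S.
      T \<subseteq> {1..N} \<and> card T = 3 \<and> T = {fst_of S T, mid_of S T, trd_of S T} \<and>
      (\<Sum>i\<in>T. acoef S T i * int (M i)) = 0 \<and> (\<Sum>i\<in>T. acoef S T i) = 0 \<and>
      (\<Sum>i\<in>T. bcoef S T i * int (M i)) = 1 \<and> (\<Sum>i\<in>T. bcoef S T i) = 0 \<and>
      (\<exists>i\<in>T. \<exists>j\<in>T. sgn (acoef S T i) \<noteq> sgn (acoef S T j)) \<and>
      (\<exists>i\<in>T. \<exists>j\<in>T. sgn (bcoef S T i) \<noteq> sgn (bcoef S T j)) \<and>
      (\<forall>k\<in>{1..K}. \<forall>l\<in>{1..L}.
        offset S T k l (fst_of S T) > 0 \<and>
        offset S T k l (mid_of S T) < 0 \<and>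
        offset S T k l (trd_of S T) > 0))"

text \<open>A virtual sample for lag \<open>k\<close> is identified by the three (sampler, sample number) pairs that
  are multiplied, so that only different products of samples are counted separately; the multiset
  then keeps different products apart even if their values coincide.\<close>

definition virtual_indices ::
  "scheme \<Rightarrow> nat \<Rightarrow> nat \<Rightarrow> ((nat \<times> int) \<times> (nat \<times> int) \<times> (nat \<times> int)) set"
where
  "virtual_indices S L k =
    {((fst_of S T, offset S T k l (fst_of S T)),
      (mid_of S T, - offset S T k l (mid_of S T)),
      (trd_of S T, offset S T k l (trd_of S T))) | T l. T \<in> selected S \<and> l \<in> {1..L}}"

definition virtual_samples ::
  "(nat \<Rightarrow> int \<Rightarrow> complex) \<Rightarrow> scheme \<Rightarrow> nat \<Rightarrow> nat \<Rightarrow> complex multiset"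
where
  "virtual_samples y S L k =
    image_mset (\<lambda>((i\<^sub>1, n\<^sub>1), (i\<^sub>2, n\<^sub>2), (i\<^sub>3, n\<^sub>3)). y i\<^sub>1 n\<^sub>1 * cnj (y i\<^sub>2 n\<^sub>2) * y i\<^sub>3 n\<^sub>3)
      (mset_set (virtual_indices S L k))"

text \<open>Only meaningful if some subset is selected and \<open>K, L \<ge> 1\<close>, since \<open>Max {}\<close> is unspecified.\<close>

definition time_delay :: "(nat \<Rightarrow> nat) \<Rightarrow> real \<Rightarrow> nat \<Rightarrow> nat \<Rightarrow> scheme \<Rightarrow> real" where
  "time_delay M Ts K L S =
    Max {of_int \<bar>offset S T k l i\<bar> * real (M i) * Ts | T i k l.
      T \<in> selected S \<and> i \<in> T \<and> k \<in> {1..K} \<and> l \<in> {1..L}}"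

end

theory Submission
  imports Defs "HOL-Analysis.Gamma_Function" "HOL-Number_Theory.Totient"
    "HOL-Computational_Algebra.Squarefree"
begin

text \<open>Take consecutive rates \<open>M\<^sub>i = M\<^sub>m\<^sub>a\<^sub>x - N + i\<close> and select the triples \<open>i < j < m\<close> whose gaps
  \<open>d = j - i\<close> and \<open>e = m - j\<close> are coprime. The coefficients \<open>a = (e, -(d + e), d)\<close> and
  \<open>b = (u, -(u + v), v)\<close>, where \<open>v e - u d = 1\<close> with \<open>0 \<le> u \<le> e\<close> and \<open>1 \<le> v \<le> d\<close>, meet all sign
  conditions and are bounded by \<open>N - 1\<close>.

  The number of selected triples is \<open>\<Sum>\<^bsub>2\<le>s<N\<^esub> (N - s) \<phi>(s)\<close>. As its main term \<open>N\<^sup>3 / \<pi>\<^sup>2\<close> agrees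
  with that of the required bound, the error must be at most \<open>(3 / \<pi>\<^sup>2 - \<epsilon>) N\<^sup>2\<close>. Moebius inversion gives
  \<open>\<Sum>\<^bsub>1\<le>s\<le>N\<^esub> (N - s) \<phi>(s) = \<Sum>\<^bsub>g\<le>N\<^esub> \<mu>(g) I(g)\<close> with
  \<open>N\<^sup>3 / (6 g\<^sup>2) - N / 6 \<le> I(g) \<le> N\<^sup>3 / (6 g\<^sup>2)\<close>, and the smoothing weight \<open>N - s\<close> keeps the error of
  each term below \<open>N / 6\<close>, so that no logarithm appears.\<close>

section \<open>The Moebius function and the totient formula\<close>

definition moebius :: "nat \<Rightarrow> real" where
  "moebius n = (if squarefree n then (-1) ^ card (prime_factors n) else 0)"

lemma moebius_1 [simp]: "moebius 1 = 1" "moebius (Suc 0) = 1"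
  by (simp_all add: moebius_def)

lemma abs_moebius_le_1: "\<bar>moebius n\<bar> \<le> 1"
  by (simp add: moebius_def power_abs)

lemma moebius_eq_0_if_4_dvd: "4 dvd n \<Longrightarrow> moebius n = 0"
  using not_squarefreeI[of 2 n] by (simp add: moebius_def power2_eq_square)

text \<open>A new prime factor flips the sign of a squarefree argument; for any other argument both
  sides are 0.\<close>

lemma moebius_prime_mult:
  assumes "prime p" "\<not> p dvd n"
  shows "moebius (p * n) = - moebius n"
proof (cases "squarefree n")
  case True
  have "coprime p n"
    using assms by (simp add: prime_imp_coprime)
  then have sf: "squarefree (p * n)"
    using True assms(1) by (simp add: squarefree_mult_coprime squarefree_prime)
  have "n \<noteq> 0" "p \<noteq> 0"
    using assms by (auto intro: Nat.gr0I)
  then have "prime_factors (p * n) = insert p (prime_factors n)"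
    using prime_prime_factors[OF assms(1)] by (simp add: prime_factors_product)
  moreover have "p \<notin> prime_factors n"
    using assms by auto
  ultimately show ?thesis
    using True sf by (simp add: moebius_def)
next
  case False
  then show ?thesis
    using squarefree_multD(2)[of p n] by (auto simp: moebius_def)
qed

text \<open>For a prime \<open>p\<close> dividing \<open>n\<close>, each divisor \<open>d\<close>
  prime to \<open>p\<close> either cancels against \<open>p * d\<close>, which again divides
  \<open>n\<close>, or is such a partner; divisors containing \<open>p^2\<close> contribute
  0.\<close>

lemma sum_moebius_divisors:
  assumes "n > 0"
  shows "(\<Sum>d | d dvd n. moebius d) = (if n = 1 then 1 else 0)"
proof (cases "n = 1")
  case False
  then obtain p where p: "prime p" "p dvd n"
    using prime_factor_nat by blast
  let ?A = "{d. d dvd n \<and> \<not> p dvd d}" and ?B = "{d. d dvd n \<and> p dvd d}"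
  have fin: "finite ?A" "finite ?B"
    using assms by auto
  have "(\<Sum>d\<in>?B. moebius d) = (\<Sum>d\<in>(*) p ` {d \<in> ?A. p * d dvd n}. moebius d)"
  proof (rule sum.mono_neutral_right[OF fin(2)])
    show "\<forall>d\<in>?B - (*) p ` {d \<in> ?A. p * d dvd n}. moebius d = 0"
    proof
      fix d assume d: "d \<in> ?B - (*) p ` {d \<in> ?A. p * d dvd n}"
      then obtain e where e: "d = p * e" by auto
      \<comment> \<open>Otherwise \<open>e\<close> would be prime to \<open>p\<close>, and
        \<open>d\<close> would lie in the image.\<close>
      then have "p dvd e"
        using d by (auto dest: dvd_mult_right)
      then have "p\<^sup>2 dvd d"
        using e by (auto simp: power2_eq_square)
      then have "\<not> squarefree d"
        using not_squarefreeI[of p d] p(1) by (auto simp: prime_nat_iff)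
      then show "moebius d = 0"
        by (simp add: moebius_def)
    qed
  qed auto
  also have "\<dots> = (\<Sum>d\<in>{d \<in> ?A. p * d dvd n}. moebius (p * d))"
    using p(1) by (subst sum.reindex) (auto simp: inj_on_def prime_gt_0_nat)
  also have "{d \<in> ?A. p * d dvd n} = ?A"
    using p by (auto intro: divides_mult prime_imp_coprime)
  also have "(\<Sum>d\<in>?A. moebius (p * d)) = - (\<Sum>d\<in>?A. moebius d)"
    using p(1) by (simp add: moebius_prime_mult sum_negf)
  finally have "(\<Sum>d\<in>?A. moebius d) + (\<Sum>d\<in>?B. moebius d) = 0"
    by simp
  moreover have "{d. d dvd n} = ?A \<union> ?B" "?A \<inter> ?B = {}"
    by auto
  ultimately have "(\<Sum>d | d dvd n. moebius d) = 0"
    using sum.union_disjoint[OF fin, of moebius] by metis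
  then show ?thesis
    using False by simp
qed simp

text \<open>The indicator of \<open>coprime j n\<close> is the Moebius sum over the divisors of
  \<open>gcd j n\<close>. After exchanging the sums, each \<open>d\<close> counts its
  \<open>n div d\<close> multiples up to \<open>n\<close>.\<close>

lemma totient_eq_sum_moebius:
  assumes "n > 0"
  shows "real (totient n) = (\<Sum>d | d dvd n. moebius d * real (n div d))"
proof -
  have fin: "finite {d. d dvd n}"
    using assms by simp
  have "real (totient n) = (\<Sum>j\<in>{0<..n}. if coprime j n then 1 else 0)"
    by (simp add: totient_def totatives_def sum.If_cases Int_def)
  also have "\<dots> = (\<Sum>j\<in>{0<..n}. \<Sum>d | d dvd n. if d dvd j then moebius d else 0)"
  proof (rule sum.cong[OF refl])
    fix j assume "j \<in> {0<..n}"
    then have "gcd j n > 0" by simp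
    have "{d. d dvd gcd j n} = {d \<in> {d. d dvd n}. d dvd j}"
      by auto
    then have "(\<Sum>d | d dvd gcd j n. moebius d) = (\<Sum>d | d dvd n. if d dvd j then moebius d else 0)"
      using sum.inter_filter[OF fin, of moebius "\<lambda>d. d dvd j"] by simp
    then show "(if coprime j n then 1 else 0) = (\<Sum>d | d dvd n. if d dvd j then moebius d else 0)"
      using sum_moebius_divisors[OF \<open>gcd j n > 0\<close>] by (simp add: coprime_iff_gcd_eq_1)
  qed
  also have "\<dots> = (\<Sum>d | d dvd n. \<Sum>j\<in>{0<..n}. if d dvd j then moebius d else 0)"
    by (rule sum.swap)
  also have "\<dots> = (\<Sum>d | d dvd n. moebius d * real (n div d))"
  proof (rule sum.cong[OF refl])
    fix d assume "d \<in> {d. d dvd n}"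
    then obtain e where e: "n = d * e" by auto
    have "d > 0" using e assms by auto
    have "{j \<in> {0<..n}. d dvd j} = (*) d ` {0<..e}"
      using e \<open>d > 0\<close> by (auto simp: image_iff elim!: dvdE)
    then have "card {j \<in> {0<..n}. d dvd j} = e"
      using \<open>d > 0\<close> by (simp add: card_image inj_on_def)
    then show "(\<Sum>j\<in>{0<..n}. if d dvd j then moebius d else 0) = moebius d * real (n div d)"
      using e \<open>d > 0\<close> by (simp add: sum.inter_filter[symmetric])
  qed
  finally show ?thesis .
qed

section \<open>The series of \<open>1 / n^2\<close> and of \<open>moebius n / n^2\<close>\<close>

lemma inverse_squares_has_sum: "((\<lambda>n. 1 / (real n)\<^sup>2) has_sum (pi\<^sup>2 / 6)) {1..}"
proof -
  have "((\<lambda>n. 1 / (real n + 1)\<^sup>2) has_sum (pi\<^sup>2 / 6)) UNIV"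
    using inverse_squares_sums by (intro sums_nonneg_imp_has_sum) (auto simp: add_ac)
  moreover have "bij_betw Suc UNIV {1..}"
    by (auto simp: bij_betw_def image_iff Suc_le_eq gr0_conv_Suc)
  ultimately show ?thesis
    using has_sum_reindex_bij_betw[of Suc UNIV "{1..}" "\<lambda>n. 1 / (real n)\<^sup>2"]
    by (simp add: add_ac)
qed

text \<open>Multiply by the series of \<open>1 / e^2\<close>, whose sum is \<open>pi^2 / 6\<close>,
  and group the double series by \<open>k = d * e\<close>. The divisor sums of
  \<open>moebius\<close> leave only the term \<open>k = 1\<close>, so the product is 1.\<close>

lemma moebius_over_squares_has_sum: "((\<lambda>d. moebius d / (real d)\<^sup>2) has_sum (6 / pi\<^sup>2)) {1..}"
proof -
  define P :: "nat set" where "P = {1..}"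
  define f where "f = (\<lambda>(d, e). moebius d / (real d)\<^sup>2 * (1 / (real e)\<^sup>2))"
  have sq: "((\<lambda>n. 1 / (real n)\<^sup>2) has_sum (pi\<^sup>2 / 6)) P"
    using inverse_squares_has_sum by (simp add: P_def)
  \<comment> \<open>The dominating double series is the square of the series of
    \<open>1 / n^2\<close>. Convergence licenses both groupings below.\<close>
  have "f abs_summable_on P \<times> P"
  proof (rule abs_summable_on_comparison_test')
    have "((\<lambda>(d, e). 1 / (real d)\<^sup>2 * (1 / (real e)\<^sup>2)) has_sum (pi\<^sup>2 / 6 * (pi\<^sup>2 / 6))) (P \<times> P)"
    proof (rule has_sum_SigmaI)
      show "((\<lambda>d. 1 / (real d)\<^sup>2 * (pi\<^sup>2 / 6)) has_sum (pi\<^sup>2 / 6 * (pi\<^sup>2 / 6))) P"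
        by (rule has_sum_cmult_left[OF sq])
      show "((\<lambda>e. case (d, e) of (d, e) \<Rightarrow> 1 / (real d)\<^sup>2 * (1 / (real e)\<^sup>2))
          has_sum (1 / (real d)\<^sup>2 * (pi\<^sup>2 / 6))) P" for d
        using has_sum_cmult_right[OF sq, of "1 / (real d)\<^sup>2"] by simp
      show "(\<lambda>(d, e). 1 / (real d)\<^sup>2 * (1 / (real e)\<^sup>2)) summable_on P \<times> P"
        using sq by (intro summable_on_SigmaI[where g = "\<lambda>d. 1 / (real d)\<^sup>2 * (pi\<^sup>2 / 6)"])
          (auto intro!: has_sum_cmult_right summable_on_cmult_left has_sum_imp_summable[OF sq]
             simp del: times_divide_eq_right times_divide_eq_left)
    qed
    then show "(\<lambda>(d, e). 1 / (real d)\<^sup>2 * (1 / (real e)\<^sup>2)) summable_on P \<times> P"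
      by (rule has_sum_imp_summable)
    show "norm (f x) \<le> (case x of (d, e) \<Rightarrow> 1 / (real d)\<^sup>2 * (1 / (real e)\<^sup>2))" for x
      using abs_moebius_le_1[of "fst x"]
      by (auto simp: f_def abs_mult split: prod.splits intro!: divide_right_mono)
  qed
  then have "f summable_on P \<times> P"
    by (rule abs_summable_summable)
  then obtain S where S: "(f has_sum S) (P \<times> P)"
    by (auto simp: summable_on_def)
  \<comment> \<open>First grouping: summing over \<open>e\<close> for fixed \<open>d\<close> gives
    the factor \<open>pi^2 / 6\<close>.\<close>
  have "((\<lambda>d. moebius d / (real d)\<^sup>2 * (pi\<^sup>2 / 6)) has_sum S) P"
    using S by (rule has_sum_SigmaD) (simp only: f_def prod.case has_sum_cmult_right[OF sq])
  then have S': "((\<lambda>d. moebius d / (real d)\<^sup>2) has_sum (S / (pi\<^sup>2 / 6))) P"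
    by (subst (asm) has_sum_cmult_left_iff) auto
  \<comment> \<open>Second grouping: by the product, with \<open>(k, d)\<close> standing for the
    pair \<open>(d, k div d)\<close>.\<close>
  have "((\<lambda>(k, d). moebius d / (real k)\<^sup>2) has_sum S) (SIGMA k:P. {d. d dvd k})"
    using S
    by (subst has_sum_reindex_bij_witness[where i = "\<lambda>(d, e). (d * e, d)"
          and j = "\<lambda>(k, d). (d, k div d)" and h = f and T = "P \<times> P" and s' = S])
      (auto simp: P_def f_def power_mult_distrib Suc_le_eq elim!: dvdE)
  then have "((\<lambda>k. \<Sum>d | d dvd k. moebius d / (real k)\<^sup>2) has_sum S) P"
    by (rule has_sum_SigmaD) (auto simp: P_def intro!: has_sum_finite)
  also have "?this \<longleftrightarrow> ((\<lambda>k. if k = 1 then 1 else 0) has_sum S) P"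
    by (intro has_sum_cong) (simp add: P_def sum_moebius_divisors flip: sum_divide_distrib)
  also have "\<dots> \<longleftrightarrow> ((\<lambda>k. 1) has_sum S) {1 :: nat}"
    by (intro has_sum_cong_neutral) (auto simp: P_def)
  finally have "S = 1"
    by (simp add: has_sum_finite_iff)
  then show ?thesis
    using S' by (simp add: P_def)
qed

text \<open>Beyond \<open>N\<close> the terms are at most \<open>1 / (n - 1) - 1 / n\<close>, which
  telescopes. The one-sided hypothesis fits both the series of \<open>1 / n^2\<close> and the
  Moebius series.\<close>

lemma has_sum_le_sum_plus_inverse:
  fixes c :: "nat \<Rightarrow> real"
  assumes c: "(c has_sum s) {1..}" and N: "N > 0"
    and le: "\<And>n. n > N \<Longrightarrow> c n \<le> 1 / (real n)\<^sup>2"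
  shows "s \<le> (\<Sum>n\<in>{1..N}. c n) + 1 / real N"
proof -
  have "((\<lambda>n. if n = 0 then 0 else c n) has_sum s) UNIV"
    using c by (subst has_sum_cong_neutral[where g = c and T = "{1..}"]) auto
  then have "(\<lambda>n. if n = 0 then 0 else c n) sums s"
    by (rule has_sum_imp_sums)
  then have "(\<lambda>n. \<Sum>i\<le>n. if i = 0 then 0 else c i) \<longlonglongrightarrow> s"
    by (simp add: sums_def_le)
  also have "(\<lambda>n. \<Sum>i\<le>n. if i = 0 then 0 else c i) = (\<lambda>n. \<Sum>i\<in>{1..n}. c i)"
    by (intro ext sum.mono_neutral_cong_right) auto
  finally have lim: "(\<lambda>n. \<Sum>i\<in>{1..n}. c i) \<longlonglongrightarrow> s" .
  have "(\<Sum>i\<in>{1..n}. c i) \<le> (\<Sum>i\<in>{1..N}. c i) + (1 / real N - 1 / real n)" if "n \<ge> N" for n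
    using that
  proof (induction n rule: dec_induct)
    case (step n)
    have "1 / (real (Suc n))\<^sup>2 \<le> 1 / real n - 1 / real (Suc n)"
    proof -
      have "n > 0" using step.hyps N by simp
      then have "1 / (real (Suc n))\<^sup>2 \<le> 1 / (real n * real (Suc n))"
        unfolding power2_eq_square by (intro divide_left_mono mult_right_mono) auto
      also have "\<dots> = 1 / real n - 1 / real (Suc n)"
        using \<open>n > 0\<close> by (simp add: field_simps)
      finally show ?thesis .
    qed
    then show ?case
      using step.IH le[of "Suc n"] step.hyps by simp
  qed simp
  then have "\<forall>n\<ge>N. (\<Sum>i\<in>{1..n}. c i) \<le> (\<Sum>i\<in>{1..N}. c i) + 1 / real N"
    by (smt (verit) divide_nonneg_nonneg of_nat_0_le_iff)
  then show ?thesis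
    using lim by (blast intro: LIMSEQ_le_const2)
qed

text \<open>Equivalent to \<open>7 / 24 < 3 / pi^2\<close>, the comparison of \<open>N^2\<close>
  coefficients that decides the count. Three terms and the tail bound give
  \<open>pi^2 <= 61 / 6\<close>.\<close>

lemma pi_squared_less: "pi\<^sup>2 < 72 / 7"
proof -
  have "pi\<^sup>2 / 6 \<le> (\<Sum>n\<in>{1..3}. 1 / (real n)\<^sup>2) + 1 / real 3"
    by (rule has_sum_le_sum_plus_inverse[OF inverse_squares_has_sum]) auto
  also have "{1..3} = {1, 2, 3 :: nat}" by auto
  finally show ?thesis by simp
qed

section \<open>The weighted sum of the totient\<close>

lemma sum_mult_diff:
  fixes x y :: real
  shows "(\<Sum>m\<in>{1..q}. real m * (x - y * real m))
    = x * (real q * (real q + 1)) / 2 - y * (real q * (real q + 1) * (2 * real q + 1)) / 6"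
  by (induction q) (simp_all add: algebra_simps add_divide_distrib diff_divide_distrib)

text \<open>Write \<open>N = g * q + r\<close> with remainder \<open>r\<close>. The gap
  \<open>N^3 / (6 g^2) - I\<close> equals \<open>(g q (g^2 - 3 r (g - r)) + r^3) / (6 g^2)\<close>.
  The inner factor is \<open>(g - 2 r)^2 + r (g - r)\<close>, so it lies between 0 and
  \<open>g^2\<close>, and the gap lies between 0 and \<open>N / 6\<close>.\<close>

lemma sum_mult_diff_bounds:
  fixes g N :: nat
  assumes "g > 0"
  defines "I \<equiv> \<Sum>m\<in>{1..N div g}. real m * (real N - real g * real m)"
  shows "I \<le> (real N) ^ 3 / (6 * (real g)\<^sup>2)"
    and "I \<ge> (real N) ^ 3 / (6 * (real g)\<^sup>2) - real N / 6"
proof -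
  define q r y where "q = real (N div g)" and "r = real (N mod g)" and "y = real g"
  have y: "y > 0" and r: "0 \<le> r" "r \<le> y" and q: "q \<ge> 0"
    using assms(1) by (auto simp: y_def r_def q_def less_imp_le)
  have N: "real N = y * q + r"
    unfolding y_def q_def r_def by (metis mult_div_mod_eq of_nat_add of_nat_mult)
  have I: "I = real N * (q * (q + 1)) / 2 - y * (q * (q + 1) * (2 * q + 1)) / 6"
    unfolding I_def q_def y_def by (rule sum_mult_diff)
  have eq: "(real N) ^ 3 / (6 * y\<^sup>2) - I
      = (y * q * (y\<^sup>2 - 3 * (r * (y - r))) + r ^ 3) / (6 * y\<^sup>2)"
    unfolding I N using y by (simp add: field_simps power2_eq_square power3_eq_cube)
  have "y\<^sup>2 - 3 * (r * (y - r)) = (y - 2 * r)\<^sup>2 + r * (y - r)"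
    by (simp add: power2_eq_square algebra_simps)
  then have "y\<^sup>2 - 3 * (r * (y - r)) \<ge> 0"
    using r by simp
  then have "(real N) ^ 3 / (6 * y\<^sup>2) - I \<ge> 0"
    unfolding eq using y r q by (intro divide_nonneg_nonneg add_nonneg_nonneg mult_nonneg_nonneg) auto
  then show "I \<le> (real N) ^ 3 / (6 * (real g)\<^sup>2)"
    by (simp add: y_def)
  have "r ^ 3 \<le> r * y\<^sup>2"
    using r y by (simp add: power3_eq_cube power2_eq_square mult.assoc mult_left_mono mult_mono)
  moreover have "y * q * (y\<^sup>2 - 3 * (r * (y - r))) \<le> y * q * y\<^sup>2"
    using r y q by (intro mult_left_mono) auto
  ultimately have "y * q * (y\<^sup>2 - 3 * (r * (y - r))) + r ^ 3 \<le> real N * y\<^sup>2"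
    unfolding N by (simp add: algebra_simps)
  then have "(real N) ^ 3 / (6 * y\<^sup>2) - I \<le> real N * y\<^sup>2 / (6 * y\<^sup>2)"
    unfolding eq by (intro divide_right_mono) auto
  then show "I \<ge> (real N) ^ 3 / (6 * (real g)\<^sup>2) - real N / 6"
    using y by (simp add: y_def)
qed

text \<open>Insert the Moebius formula for \<open>totient s\<close>, put \<open>s = g * m\<close>
  and regroup by \<open>g\<close>; \<open>s <= N\<close> becomes
  \<open>m <= N div g\<close>.\<close>

lemma weighted_totient_sum_eq:
  "(\<Sum>s\<in>{1..N}. (real N - real s) * real (totient s))
    = (\<Sum>g\<in>{1..N}. moebius g * (\<Sum>m\<in>{1..N div g}. real m * (real N - real g * real m)))"
proof -
  have "(\<Sum>s\<in>{1..N}. (real N - real s) * real (totient s))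
      = (\<Sum>s\<in>{1..N}. \<Sum>g | g dvd s. moebius g * real (s div g) * (real N - real s))"
    by (intro sum.cong refl) (simp add: totient_eq_sum_moebius sum_distrib_left mult_ac)
  also have "\<dots> = (\<Sum>(s, g)\<in>(SIGMA s:{1..N}. {g. g dvd s}).
      moebius g * real (s div g) * (real N - real s))"
    by (subst sum.Sigma) auto
  also have "\<dots> = (\<Sum>(g, m)\<in>(SIGMA g:{1..N}. {1..N div g}).
      moebius g * (real m * (real N - real g * real m)))"
  proof (rule sum.reindex_bij_witness[where i = "\<lambda>(g, m). (g * m, g)"
        and j = "\<lambda>(s, g). (g, s div g)"])
    fix x assume "x \<in> (SIGMA s:{1..N}. {g. g dvd s})"
    then obtain g m where x: "x = (g * m, g)" "1 \<le> g * m" "g * m \<le> N"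
      by (auto elim!: dvdE)
    then have "g \<ge> 1" "m \<ge> 1"
      by (simp_all add: Suc_le_eq)
    moreover have "g \<le> N"
      using x(3) \<open>m \<ge> 1\<close> by (metis dvd_imp_le dvd_triv_left le_trans mult_eq_0_iff not_gr0 not_one_le_zero x(2))
    ultimately show "(case x of (s, g) \<Rightarrow> (g, s div g)) \<in> (SIGMA g:{1..N}. {1..N div g})"
      and "(\<lambda>(g, m). (g * m, g)) (case x of (s, g) \<Rightarrow> (g, s div g)) = x"
      and "(case case x of (s, g) \<Rightarrow> (g, s div g) of (g, m) \<Rightarrow>
          moebius g * (real m * (real N - real g * real m)))
        = (case x of (s, g) \<Rightarrow> moebius g * real (s div g) * (real N - real s))"
      using x by (auto simp: less_eq_div_iff_mult_less_eq mult.commute)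
  next
    fix x assume "x \<in> (SIGMA g:{1..N}. {1..N div g})"
    then show "(case x of (g, m) \<Rightarrow> (g * m, g)) \<in> (SIGMA s:{1..N}. {g. g dvd s})"
      and "(\<lambda>(s, g). (g, s div g)) (case x of (g, m) \<Rightarrow> (g * m, g)) = x"
      by (auto simp: less_eq_div_iff_mult_less_eq mult.commute Suc_le_eq)
  qed
  also have "\<dots> = (\<Sum>g\<in>{1..N}. \<Sum>m\<in>{1..N div g}. moebius g * (real m * (real N - real g * real m)))"
    by (subst sum.Sigma) auto
  finally show ?thesis
    by (simp add: sum_distrib_left)
qed

text \<open>These are the \<open>g\<close> whose error term survives; there are
  \<open>N - N div 4\<close> of them, and \<open>N div 4\<close> is at least
  \<open>(N - 3) / 4\<close>.\<close>

lemma card_not_4_dvd: "real (card {g \<in> {1..N}. \<not> 4 dvd g}) \<le> (3 * real N + 3) / 4"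
proof -
  have "{g \<in> {1..N}. 4 dvd g} = (*) 4 ` {1..N div 4}"
    by (auto simp: image_iff elim!: dvdE)
  then have "card {g \<in> {1..N}. 4 dvd g} = N div 4"
    by (simp add: card_image inj_on_def)
  moreover have "{g \<in> {1..N}. \<not> 4 dvd g} = {1..N} - {g \<in> {1..N}. 4 dvd g}"
    by auto
  moreover have "card ({1..N} - {g \<in> {1..N}. 4 dvd g}) = card {1..N} - card {g \<in> {1..N}. 4 dvd g}"
    by (intro card_Diff_subset) auto
  ultimately have "card {g \<in> {1..N}. \<not> 4 dvd g} = N - N div 4"
    by simp
  then have "4 * card {g \<in> {1..N}. \<not> 4 dvd g} \<le> 3 * N + 3"
    by simp
  then have "real (4 * card {g \<in> {1..N}. \<not> 4 dvd g}) \<le> real (3 * N + 3)"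
    by (rule of_nat_mono)
  then show ?thesis
    by simp
qed

text \<open>The trivial bounds \<open>\<bar>\<mu>\<bar> \<le> 1\<close> for the error terms would give the constant
  \<open>1 / 3 > 3 / \<pi>\<^sup>2\<close> in place of \<open>7 / 24\<close>, which is too weak for the theorem; that \<open>\<mu>\<close> vanishes
  on multiples of 4 gains just enough.\<close>

lemma weighted_totient_sum_ge:
  assumes "N > 0"
  shows "(\<Sum>s\<in>{1..N}. (real N - real s) * real (totient s))
    \<ge> (real N) ^ 3 / pi\<^sup>2 - 7 / 24 * (real N)\<^sup>2 - real N / 8"
proof -
  define I where "I g = (\<Sum>m\<in>{1..N div g}. real m * (real N - real g * real m))" for g
  have term_ge: "(real N) ^ 3 / 6 * (moebius g / (real g)\<^sup>2) - (if \<not> 4 dvd g then real N / 6 else 0)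
      \<le> moebius g * I g" if "g \<in> {1..N}" for g
  proof (cases "4 dvd g")
    case False
    define A where "A = (real N) ^ 3 / (6 * (real g)\<^sup>2)"
    have "\<bar>I g - A\<bar> \<le> real N / 6"
      using sum_mult_diff_bounds[of g N] that by (auto simp: A_def I_def)
    then have "\<bar>moebius g * (I g - A)\<bar> \<le> 1 * (real N / 6)"
      unfolding abs_mult using abs_moebius_le_1 by (intro mult_mono) auto
    moreover have "moebius g * (I g - A) = moebius g * I g - (real N) ^ 3 / 6 * (moebius g / (real g)\<^sup>2)"
      by (simp add: A_def algebra_simps)
    ultimately show ?thesis
      unfolding if_P[OF False] by linarith
  qed (simp add: moebius_eq_0_if_4_dvd)
  \<comment> \<open>Cutting the series at \<open>N\<close> costs
    \<open>N^3 / 6 * (1 / N) = N^2 / 6\<close>. The error terms below cost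
    \<open>N^2 / 8 + N / 8\<close>, and \<open>1 / 6 + 1 / 8 = 7 / 24\<close>.\<close>
  have "6 / pi\<^sup>2 \<le> (\<Sum>g\<in>{1..N}. moebius g / (real g)\<^sup>2) + 1 / real N"
    using abs_moebius_le_1 assms
    by (intro has_sum_le_sum_plus_inverse[OF moebius_over_squares_has_sum])
      (auto intro!: divide_right_mono simp: abs_le_iff)
  then have "(real N) ^ 3 / 6 * (6 / pi\<^sup>2 - 1 / real N)
      \<le> (real N) ^ 3 / 6 * (\<Sum>g\<in>{1..N}. moebius g / (real g)\<^sup>2)"
    by (intro mult_left_mono) auto
  moreover have "(real N) ^ 3 / 6 * (6 / pi\<^sup>2 - 1 / real N) = (real N) ^ 3 / pi\<^sup>2 - (real N)\<^sup>2 / 6"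
    using assms by (simp add: field_simps power2_eq_square power3_eq_cube)
  moreover have "(\<Sum>g\<in>{1..N}. if \<not> 4 dvd g then real N / 6 else 0) \<le> (3 * real N + 3) / 4 * (real N / 6)"
  proof -
    have "(\<Sum>g\<in>{1..N}. if \<not> 4 dvd g then real N / 6 else 0)
        = real (card {g \<in> {1..N}. \<not> 4 dvd g}) * (real N / 6)"
      by (subst sum.inter_filter[symmetric]) auto
    also have "\<dots> \<le> (3 * real N + 3) / 4 * (real N / 6)"
      using card_not_4_dvd by (rule mult_right_mono) simp
    finally show ?thesis .
  qed
  moreover have "(3 * real N + 3) / 4 * (real N / 6) = (real N)\<^sup>2 / 8 + real N / 8"
    by (simp add: field_simps power2_eq_square)
  moreover have "(\<Sum>g\<in>{1..N}. (real N) ^ 3 / 6 * (moebius g / (real g)\<^sup>2)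
      - (if \<not> 4 dvd g then real N / 6 else 0)) \<le> (\<Sum>g\<in>{1..N}. moebius g * I g)"
    by (rule sum_mono) (rule term_ge)
  ultimately show ?thesis
    unfolding weighted_totient_sum_eq I_def[symmetric]
    by (simp only: sum_subtractf flip: sum_distrib_left)
qed

section \<open>Counting the coprime triples\<close>

definition coprime_triples :: "nat \<Rightarrow> nat set set" where
  "coprime_triples N = {{i, j, m} | i j m.
    1 \<le> i \<and> i < j \<and> j < m \<and> m \<le> N \<and> coprime (j - i) (m - j)}"

lemma finite_coprime_triples [simp]: "finite (coprime_triples N)"
  by (rule finite_subset[of _ "Pow {1..N}"]) (auto simp: coprime_triples_def)

text \<open>A finite set has only one strictly increasing enumeration. This makes the
  parametrization of triples injective.\<close>

lemma ordered_triple_eq_iff: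
  fixes i j m :: "'a :: linorder"
  assumes "i < j" "j < m" "i' < j'" "j' < m'"
  shows "{i, j, m} = {i', j', m'} \<longleftrightarrow> i = i' \<and> j = j' \<and> m = m'"
proof
  assume "{i, j, m} = {i', j', m'}"
  then have "[i, j, m] = [i', j', m']"
    using assms by (intro strict_sorted_equal) simp_all
  then show "i = i' \<and> j = j' \<and> m = m'"
    by simp
qed simp

text \<open>A triple is determined by its spread \<open>s\<close>, its least element and the first gap \<open>d\<close>;
  its gaps \<open>d\<close> and \<open>s - d\<close> are coprime iff \<open>d\<close> and \<open>s\<close> are.\<close>

lemma card_coprime_triples_ge:
  "card (coprime_triples N) \<ge> (\<Sum>s\<in>{2..<N}. (N - s) * totient s)"
proof -
  define X where "X = (SIGMA s:{2..<N}. {1..N - s} \<times> totatives s)"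
  define f where "f = (\<lambda>(s, i, d). {i, i + d, i + s :: nat})"
  \<comment> \<open>For \<open>s = 1\<close> the number \<open>s\<close> would itself be a totative;
    \<open>s >= 2\<close> excludes this and keeps both gaps positive.\<close>
  have less: "0 < d" "d < s" if "s \<ge> 2" "d \<in> totatives s" for s d :: nat
    using that totatives_less[of d s] by (auto simp: in_totatives_iff)
  have "inj_on f X"
  proof (rule inj_onI)
    fix x y assume "x \<in> X" "y \<in> X" "f x = f y"
    moreover obtain s i d s' i' d' where xy: "x = (s, i, d)" "y = (s', i', d')"
      by (metis prod_cases3)
    ultimately show "x = y"
      using ordered_triple_eq_iff[of i "i + d" "i + s" i' "i' + d'" "i' + s'"] less
      by (auto simp: X_def f_def)
  qed
  moreover have "f ` X \<subseteq> coprime_triples N"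
  proof
    fix T assume "T \<in> f ` X"
    then obtain s i d where T: "T = {i, i + d, i + s}" and s: "2 \<le> s" "s < N"
      and i: "1 \<le> i" "i \<le> N - s" and d: "d \<in> totatives s"
      by (auto simp: X_def f_def)
    have "coprime d s" using d by (simp add: in_totatives_iff)
    moreover have "gcd (s - d) d = gcd s d"
      using less[OF s(1) d] by (simp add: gcd_diff1_nat)
    ultimately have "coprime (i + d - i) (i + s - (i + d))"
      by (simp add: coprime_iff_gcd_eq_1 gcd.commute)
    then show "T \<in> coprime_triples N"
      unfolding coprime_triples_def T using s i less[OF s(1) d]
      by - (rule CollectI, rule exI[of _ i], rule exI[of _ "i + d"], rule exI[of _ "i + s"], auto)
  qed
  ultimately have "card X \<le> card (coprime_triples N)"
    by (intro card_inj_on_le) auto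
  moreover have "card X = (\<Sum>s\<in>{2..<N}. (N - s) * totient s)"
    by (simp add: X_def card_cartesian_product totient_def)
  ultimately show ?thesis
    by simp
qed

text \<open>Expanding \<open>N (N - 1) (N - 2)\<close> gives \<open>- 3 N^2\<close>. Scaled by
  \<open>1 / pi^2\<close>, this outweighs the loss \<open>7 / 24 N^2\<close> of the totient sum, and
  the linear terms are absorbed for large \<open>N\<close>.\<close>

lemma eventually_card_coprime_triples_ge:
  "\<forall>\<^sub>F N in sequentially.
    real (card (coprime_triples N)) \<ge> 1 / pi\<^sup>2 * real N * (real N - 1) * (real N - 2)"
proof -
  define c where "c = 1 / pi\<^sup>2"
  have c: "7 / 24 < 3 * c" "c \<le> 1"
    using pi_squared_less pi_ge_two power_mono[of 2 pi 2] by (auto simp: c_def field_simps)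
  \<comment> \<open>Beyond this threshold the quadratic surplus is at least \<open>4 N\<close>,
    which covers the linear terms \<open>2 c N\<close>, \<open>N / 8\<close> and \<open>N\<close>,
    as \<open>c <= 1\<close>.\<close>
  have "\<forall>\<^sub>F N in sequentially. real N \<ge> max 2 (4 / (3 * c - 7 / 24))"
    using filterlim_real_sequentially unfolding filterlim_at_top by blast
  then show ?thesis
  proof eventually_elim
    case (elim N)
    then have "real N \<ge> 2" by simp
    then have N: "N \<ge> 2" by linarith
    have "4 \<le> (3 * c - 7 / 24) * real N"
      using elim c by (simp add: field_simps)
    then have "4 * real N \<le> (3 * c - 7 / 24) * real N * real N"
      by (rule mult_right_mono) simp
    moreover have "c * real N \<le> 1 * real N"
      using c by (intro mult_right_mono) auto
    ultimately have "c * real N * (real N - 1) * (real N - 2)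
        \<le> (real N) ^ 3 * c - 7 / 24 * (real N)\<^sup>2 - real N / 8 - (real N - 1)"
      by (simp add: algebra_simps power2_eq_square power3_eq_cube)
    also have "\<dots> \<le> (\<Sum>s\<in>{1..N}. (real N - real s) * real (totient s)) - (real N - 1)"
      using weighted_totient_sum_ge[of N] N by (simp add: c_def)
    \<comment> \<open>The term \<open>s = 1\<close> is the subtracted \<open>N - 1\<close>, and the
      term \<open>s = N\<close> is 0.\<close>
    also have "{1..N} = insert 1 (insert N {2..<N})"
      using N by auto
    also have "(\<Sum>s\<in>insert 1 (insert N {2..<N}). (real N - real s) * real (totient s)) - (real N - 1)
        = (\<Sum>s\<in>{2..<N}. (real N - real s) * real (totient s))"
      using N by simp
    also have "\<dots> = real (\<Sum>s\<in>{2..<N}. (N - s) * totient s)"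
      by (simp add: of_nat_diff)
    also have "\<dots> \<le> real (card (coprime_triples N))"
      using card_coprime_triples_ge by (intro of_nat_mono)
    finally show ?case
      by (simp add: c_def)
  qed
qed

section \<open>Construction of the scheme\<close>

text \<open>Reduce a Bezout coefficient modulo \<open>e\<close> to get \<open>u\<close>; then
  \<open>e\<close> divides \<open>1 + u * d\<close>, and \<open>v\<close> is the quotient. From
  \<open>u <= e - 1\<close> follows \<open>e * v <= 1 + (e - 1) * d <= e * d\<close>. The bounds
  give \<open>u + v <= d + e\<close>.\<close>

lemma coprime_obtain_bounded_bezout:
  fixes d e :: int
  assumes "coprime d e" "d > 0" "e > 0"
  obtains u v where "v * e - u * d = 1" "0 \<le> u" "u \<le> e" "1 \<le> v" "v \<le> d"
proof -
  obtain x y where xy: "x * d + y * e = 1"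
    using bezout_int[of d e] assms(1) by (auto simp: coprime_iff_gcd_eq_1)
  define u where "u = (- x) mod e"
  have u: "0 \<le> u" "u < e"
    using assms by (auto simp: u_def)
  have "e dvd 1 + u * d"
  proof -
    have "u = - x - e * ((- x) div e)"
      unfolding u_def by (simp add: minus_mult_div_eq_mod)
    then have "1 + u * d = 1 - x * d - e * ((- x) div e) * d"
      by (simp only:) (simp add: algebra_simps)
    also have "\<dots> = e * (y - (- x) div e * d)"
      using xy by (simp add: algebra_simps)
    finally show ?thesis by simp
  qed
  then obtain v where v: "1 + u * d = e * v" by auto
  have "v * e > 0"
    using v u assms by (metis add_pos_nonneg less_imp_le mult.commute mult_nonneg_nonneg zero_less_one)
  then have "v \<ge> 1"
    using assms by (simp add: zero_less_mult_iff)
  have "u * d \<le> (e - 1) * d"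
    using u assms by (intro mult_right_mono) auto
  moreover have "(e - 1) * d = e * d - d"
    by (simp add: algebra_simps)
  ultimately have "e * v \<le> e * d"
    using v assms by linarith
  then have "v \<le> d"
    using assms(3) by (simp only: mult_le_cancel_left_pos)
  then show ?thesis
    using that[of v u] u v \<open>v \<ge> 1\<close> by (simp add: algebra_simps)
qed

text \<open>As the coefficients sum to 0, the shift \<open>P\<close> cancels and only the gaps
  matter: the conditions become \<open>d e - e d = 0\<close> and \<open>v e - u d = 1\<close>. The
  nonzero \<open>acoef\<close> is recorded to tell different \<open>l\<close> apart when samples are
  counted.\<close>

lemma exists_scheme_on_coprime_triples:
  assumes M: "\<And>i. M i = P + i"
  obtains S where "selected S = coprime_triples N" "coprime_scheme N M K L S"
    "\<And>T. T \<in> selected S \<Longrightarrow> acoef S T (fst_of S T) \<noteq> 0"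
    "\<And>T i k l. T \<in> selected S \<Longrightarrow> i \<in> T \<Longrightarrow> \<bar>offset S T k l i\<bar> \<le> (int k + int l) * (int N - 1)"
proof -
  \<comment> \<open>Bundles all data of one triple, so that a single choice yields them as functions
    of \<open>T\<close>.\<close>
  define Q where "Q T i j m u v \<longleftrightarrow> T = {i, j, m} \<and> 1 \<le> i \<and> i < j \<and> j < m \<and> m \<le> N \<and>
    v * (int m - int j) - u * (int j - int i) = 1 \<and>
    0 \<le> u \<and> u \<le> int m - int j \<and> 1 \<le> v \<and> v \<le> int j - int i" for T i j m u v
  have "\<exists>i j m u v. Q T i j m u v" if *: "T \<in> coprime_triples N" for T
  proof -
    obtain i j m where T: "T = {i, j, m}" "1 \<le> i" "i < j" "j < m" "m \<le> N" "coprime (j - i) (m - j)"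
      using * unfolding coprime_triples_def by blast
    then have "coprime (int (j - i)) (int (m - j))"
      by (simp only: coprime_int_iff)
    then have "coprime (int j - int i) (int m - int j)"
      using T by (simp add: of_nat_diff)
    then obtain u v where "v * (int m - int j) - u * (int j - int i) = 1"
      "0 \<le> u" "u \<le> int m - int j" "1 \<le> v" "v \<le> int j - int i"
      using coprime_obtain_bounded_bezout T by (metis diff_gt_0_iff_gt of_nat_less_iff)
    then show ?thesis
      using T unfolding Q_def by blast
  qed
  then obtain i j m u v where Q: "\<And>T. T \<in> coprime_triples N \<Longrightarrow> Q T (i T) (j T) (m T) (u T) (v T)"
    by metis
  define S where "S = \<lparr>selected = coprime_triples N, fst_of = i, mid_of = j, trd_of = m,
    acoef = (\<lambda>T x. if x = i T then int (m T) - int (j T) else if x = j T then int (i T) - int (m T)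
      else int (j T) - int (i T)),
    bcoef = (\<lambda>T x. if x = i T then u T else if x = j T then - u T - v T else v T)\<rparr>"
  have T: "T = {i T, j T, m T}" "1 \<le> i T" "i T < j T" "j T < m T" "m T \<le> N"
    "v T * (int (m T) - int (j T)) - u T * (int (j T) - int (i T)) = 1"
    "0 \<le> u T" "u T \<le> int (m T) - int (j T)" "1 \<le> v T" "v T \<le> int (j T) - int (i T)"
    if "T \<in> coprime_triples N" for T
    using Q[OF that] by (simp_all add: Q_def)
  have sum_T: "sum f T = f (i T) + f (j T) + f (m T)" if "T \<in> coprime_triples N" for f :: "nat \<Rightarrow> int" and T
    using arg_cong[OF T(1)[OF that], of "sum f"] T(3,4)[OF that] by simp
  have coef: "acoef S T (i T) = int (m T) - int (j T)" "acoef S T (j T) = int (i T) - int (m T)"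
    "acoef S T (m T) = int (j T) - int (i T)" "bcoef S T (i T) = u T"
    "bcoef S T (j T) = - u T - v T" "bcoef S T (m T) = v T"
    if "T \<in> coprime_triples N" for T
    using T(3,4)[OF that] by (auto simp: S_def)
  have offset: "offset S T k l (i T) = int k * u T + int l * (int (m T) - int (j T))"
    "offset S T k l (j T) = - (int k * (u T + v T) + int l * (int (m T) - int (i T)))"
    "offset S T k l (m T) = int k * v T + int l * (int (j T) - int (i T))"
    if "T \<in> coprime_triples N" for T k l
    by (simp_all add: offset_def coef[OF that] algebra_simps)
  show ?thesis
  proof (rule that[of S])
    show "selected S = coprime_triples N"
      by (simp add: S_def)
    show "acoef S T (fst_of S T) \<noteq> 0" if "T \<in> selected S" for T
      using that T(4)[of T] by (simp add: S_def)
    show "coprime_scheme N M K L S"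
      unfolding coprime_scheme_def
    proof
      fix T assume "T \<in> selected S"
      then have T': "T \<in> coprime_triples N"
        by (simp add: S_def)
      have roles: "fst_of S T = i T" "mid_of S T = j T" "trd_of S T = m T"
        by (simp_all add: S_def)
      note t = T[OF T']
      have in_T: "j T \<in> T" "m T \<in> T"
        by (subst t(1), blast)+
      have "T \<subseteq> {1..N}" "card T = 3"
        using t(2-5) by (subst t(1), simp)+
      moreover have "T = {fst_of S T, mid_of S T, trd_of S T}"
        unfolding roles by (rule t(1))
      moreover have "(\<Sum>x\<in>T. acoef S T x * int (M x)) = 0" "(\<Sum>x\<in>T. acoef S T x) = 0"
        "(\<Sum>x\<in>T. bcoef S T x) = 0"
        by (simp_all add: sum_T[OF T'] coef[OF T'] M algebra_simps)
      moreover have "(\<Sum>x\<in>T. bcoef S T x * int (M x)) = 1"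
        using t(6) by (simp add: sum_T[OF T'] coef[OF T'] M algebra_simps)
      moreover have "\<exists>x\<in>T. \<exists>y\<in>T. sgn (acoef S T x) \<noteq> sgn (acoef S T y)"
        using t(2-) in_T by - (rule bexI[of _ "m T"], rule bexI[of _ "j T"], auto simp: coef[OF T'])
      moreover have "\<exists>x\<in>T. \<exists>y\<in>T. sgn (bcoef S T x) \<noteq> sgn (bcoef S T y)"
        using t(2-) in_T by - (rule bexI[of _ "m T"], rule bexI[of _ "j T"], auto simp: coef[OF T'])
      \<comment> \<open>As \<open>u\<close> may be 0, strictness comes from the multiple of
        \<open>l >= 1\<close>, whose factor is a positive difference of indices.\<close>
      moreover have "\<forall>k\<in>{1..K}. \<forall>l\<in>{1..L}. offset S T k l (fst_of S T) > 0 \<and>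
          offset S T k l (mid_of S T) < 0 \<and> offset S T k l (trd_of S T) > 0"
        unfolding roles offset[OF T'] neg_less_0_iff_less using t(2-)
        by (auto intro!: add_nonneg_pos mult_nonneg_nonneg mult_pos_pos)
      ultimately show "T \<subseteq> {1..N} \<and> card T = 3 \<and> T = {fst_of S T, mid_of S T, trd_of S T} \<and>
        (\<Sum>i\<in>T. acoef S T i * int (M i)) = 0 \<and> (\<Sum>i\<in>T. acoef S T i) = 0 \<and>
        (\<Sum>i\<in>T. bcoef S T i * int (M i)) = 1 \<and> (\<Sum>i\<in>T. bcoef S T i) = 0 \<and>
        (\<exists>i\<in>T. \<exists>j\<in>T. sgn (acoef S T i) \<noteq> sgn (acoef S T j)) \<and>
        (\<exists>i\<in>T. \<exists>j\<in>T. sgn (bcoef S T i) \<noteq> sgn (bcoef S T j)) \<and>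
        (\<forall>k\<in>{1..K}. \<forall>l\<in>{1..L}.
          offset S T k l (fst_of S T) > 0 \<and>
          offset S T k l (mid_of S T) < 0 \<and>
          offset S T k l (trd_of S T) > 0)"
        by - (intro conjI; assumption)
    qed
    show "\<bar>offset S T k l x\<bar> \<le> (int k + int l) * (int N - 1)"
      if "T \<in> selected S" "x \<in> T" for T x k l
    proof -
      have T': "T \<in> coprime_triples N"
        using that by (simp add: S_def)
      note t = T[OF T']
      have x: "x = i T \<or> x = j T \<or> x = m T"
        using that(2) by (subst (asm) t(1)) simp
      \<comment> \<open>The middle sampler has the largest coefficients: \<open>d + e\<close> and
        \<open>u + v <= d + e\<close>, where \<open>d + e\<close> is the spread of the
        triple.\<close>
      have "\<bar>acoef S T x\<bar> \<le> int N - 1" "\<bar>bcoef S T x\<bar> \<le> int N - 1"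
        using x t(2-) by (auto simp: coef[OF T'])
      then have "int k * \<bar>bcoef S T x\<bar> + int l * \<bar>acoef S T x\<bar>
          \<le> int k * (int N - 1) + int l * (int N - 1)"
        by (intro add_mono mult_left_mono) auto
      moreover have "\<bar>offset S T k l x\<bar> \<le> int k * \<bar>bcoef S T x\<bar> + int l * \<bar>acoef S T x\<bar>"
        unfolding offset_def by (rule order_trans[OF abs_triangle_ineq]) (simp add: abs_mult)
      ultimately show ?thesis
        by (simp add: algebra_simps)
    qed
  qed
qed

section \<open>Number of virtual samples and time delay\<close>

text \<open>No product is counted twice: its three sampler numbers determine \<open>T\<close>, and
  then its first sample number determines \<open>l\<close>, because \<open>acoef\<close> is nonzero
  there.\<close>

lemma size_virtual_samples:
  assumes "coprime_scheme N M K L S"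
    and nz: "\<And>T. T \<in> selected S \<Longrightarrow> acoef S T (fst_of S T) \<noteq> 0"
  shows "size (virtual_samples y S L k) = card (selected S) * L"
proof -
  define f where "f = (\<lambda>(T, l). ((fst_of S T, offset S T k l (fst_of S T)),
      (mid_of S T, - offset S T k l (mid_of S T)),
      (trd_of S T, offset S T k l (trd_of S T))))"
  have T: "T = {fst_of S T, mid_of S T, trd_of S T}" if "T \<in> selected S" for T
    using bspec[OF assms(1)[unfolded coprime_scheme_def] that] by (elim conjE)
  have "inj_on f (selected S \<times> {1..L})"
  proof (rule inj_onI, clarify)
    fix T l T' l' assume *: "T \<in> selected S" "T' \<in> selected S" "f (T, l) = f (T', l')"
    note T[OF *(1)]
    also have "{fst_of S T, mid_of S T, trd_of S T} = {fst_of S T', mid_of S T', trd_of S T'}"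
      using *(3) by (simp add: f_def)
    also note T[OF *(2), symmetric]
    finally have "T = T'" .
    then show "T = T' \<and> l = l'"
      using * nz[of T] by (simp add: f_def offset_def)
  qed
  moreover have "virtual_indices S L k = {f (T, l) | T l. T \<in> selected S \<and> l \<in> {1..L}}"
    by (simp add: virtual_indices_def f_def)
  then have "virtual_indices S L k = f ` (selected S \<times> {1..L})"
    by blast
  ultimately have "card (virtual_indices S L k) = card (selected S) * L"
    by (simp add: card_image card_cartesian_product)
  then show ?thesis
    by (simp add: virtual_samples_def)
qed

text \<open>Besides the bound on each element, \<open>Max\<close> requires a finite nonempty set; a
  member of \<open>T\<^sub>0\<close> with \<open>k = l = 1\<close> witnesses nonemptiness.\<close>

lemma time_delay_le:
  assumes "finite (selected S)" "T\<^sub>0 \<in> selected S" "T\<^sub>0 \<noteq> {}" "K \<ge> 1" "L \<ge> 1"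
    and fin: "\<And>T. T \<in> selected S \<Longrightarrow> finite T"
    and le: "\<And>T i k l. T \<in> selected S \<Longrightarrow> i \<in> T \<Longrightarrow> k \<in> {1..K} \<Longrightarrow> l \<in> {1..L} \<Longrightarrow>
      of_int \<bar>offset S T k l i\<bar> * real (M i) * Ts \<le> B"
  shows "time_delay M Ts K L S \<le> B"
proof -
  let ?f = "\<lambda>(T, i, k, l). of_int \<bar>offset S T k l i\<bar> * real (M i) * Ts"
  let ?X = "SIGMA T:selected S. T \<times> {1..K} \<times> {1..L}"
  let ?D = "{of_int \<bar>offset S T k l i\<bar> * real (M i) * Ts | T i k l.
      T \<in> selected S \<and> i \<in> T \<and> k \<in> {1..K} \<and> l \<in> {1..L}}"
  have "?D \<subseteq> ?f ` ?X"
  proof clarify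
    fix T i k l assume "T \<in> selected S" "i \<in> T" "k \<in> {1..K}" "l \<in> {1..L}"
    then show "of_int \<bar>offset S T k l i\<bar> * real (M i) * Ts \<in> ?f ` ?X"
      by (intro image_eqI[of _ _ "(T, i, k, l)"]) auto
  qed
  moreover have "finite (?f ` ?X)"
    using assms(1) fin by (intro finite_imageI finite_SigmaI) auto
  ultimately have "finite ?D"
    by (rule finite_subset)
  obtain i where "i \<in> T\<^sub>0"
    using assms(3) by auto
  then have "of_int \<bar>offset S T\<^sub>0 1 1 i\<bar> * real (M i) * Ts \<in> ?D"
    using assms by (intro CollectI exI[of _ T\<^sub>0] exI[of _ i] exI[of _ 1]) auto
  then have "?D \<noteq> {}"
    by blast
  then show ?thesis
    unfolding time_delay_def using \<open>finite ?D\<close> le by (subst Max_le_iff) auto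
qed

text \<open>The rates are chosen together with the scheme, and the threshold on \<open>N\<close> is
  uniform in the largest rate, \<open>K\<close>, \<open>L\<close> and \<open>Ts\<close>. That the
  largest rate is at least \<open>N\<close> makes room for \<open>N\<close> consecutive positive
  rates below it.\<close>

theorem theorem2:
  "\<forall>\<^sub>F N :: nat in sequentially.
    \<forall>(M\<^sub>m\<^sub>a\<^sub>x :: nat) (K :: nat) (L :: nat) (Ts :: real).
      N \<le> M\<^sub>m\<^sub>a\<^sub>x \<longrightarrow> 1 \<le> K \<longrightarrow> 1 \<le> L \<longrightarrow> 0 < Ts \<longrightarrow>
      (\<exists>(M :: nat \<Rightarrow> nat) (S :: scheme).
        (\<forall>i\<in>{1..N}. 0 < M i) \<and> Max (M ` {1..N}) = M\<^sub>m\<^sub>a\<^sub>x \<and>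
        coprime_scheme N M K L S \<and>
        (\<forall>D A \<omega> \<phi> w. \<forall>k\<in>{1..K}.
          real (size (virtual_samples (sampler_output (waveform D A \<omega> \<phi>) w M Ts) S L k))
            \<ge> real L * (1 / pi\<^sup>2) * real N * (real N - 1) * (real N - 2)) \<and>
        time_delay M Ts K L S
          \<le> 2 * (real N - 1) * (real K + real L) * real (Max (M ` {1..N})) * Ts)"
  using eventually_card_coprime_triples_ge eventually_ge_at_top[of 3]
proof eventually_elim
  case (elim N)
  show ?case
  proof (intro allI impI)
    fix M\<^sub>m\<^sub>a\<^sub>x K L :: nat and Ts :: real
    assume le: "N \<le> M\<^sub>m\<^sub>a\<^sub>x" and KL: "1 \<le> K" "1 \<le> L" and Ts: "0 < Ts"
    define M where "M i = M\<^sub>m\<^sub>a\<^sub>x - N + i" for i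
    obtain S where sel: "selected S = coprime_triples N" and S: "coprime_scheme N M K L S"
      and nz: "\<And>T. T \<in> selected S \<Longrightarrow> acoef S T (fst_of S T) \<noteq> 0"
      and off: "\<And>T i k l. T \<in> selected S \<Longrightarrow> i \<in> T \<Longrightarrow>
        \<bar>offset S T k l i\<bar> \<le> (int k + int l) * (int N - 1)"
      using exists_scheme_on_coprime_triples[OF M_def] by blast
    have Max: "Max (M ` {1..N}) = M\<^sub>m\<^sub>a\<^sub>x"
      using le elim(2) by (intro Max_eqI) (auto simp: M_def image_iff intro!: bexI[of _ N])
    have T: "T \<subseteq> {1..N}" if "T \<in> selected S" for T
      using bspec[OF S[unfolded coprime_scheme_def] that] by (elim conjE)
    \<comment> \<open>Both gaps are 1. This triple, available since \<open>N >= 3\<close>, makes the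
      set under \<open>Max\<close> nonempty.\<close>
    have "{1, 2, 3} \<in> selected S"
      unfolding sel coprime_triples_def using elim(2)
      by - (rule CollectI, rule exI[of _ 1], rule exI[of _ 2], rule exI[of _ 3], auto)
    then have delay: "time_delay M Ts K L S \<le> 2 * (real N - 1) * (real K + real L) * real M\<^sub>m\<^sub>a\<^sub>x * Ts"
    proof (rule time_delay_le[rotated])
      fix T i k l assume *: "T \<in> selected S" "i \<in> T" "k \<in> {1..K}" "l \<in> {1..L}"
      have "real_of_int \<bar>offset S T k l i\<bar> \<le> real_of_int ((int k + int l) * (int N - 1))"
        using off[OF *(1,2), of k l] by (simp only: of_int_le_iff)
      also have "\<dots> = (real k + real l) * (real N - 1)"
        by simp
      \<comment> \<open>The construction already stays within \<open>(K + L) (N - 1)\<close>;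
        doubling matches the stated form.\<close>
      also have "\<dots> \<le> (real K + real L) * (2 * (real N - 1))"
        using *(3,4) elim(2) by (intro mult_mono add_mono) auto
      finally have "real_of_int \<bar>offset S T k l i\<bar> * real (M i)
          \<le> (real K + real L) * (2 * (real N - 1)) * real M\<^sub>m\<^sub>a\<^sub>x"
        using T[OF *(1)] *(2) le elim(2) by (intro mult_mono) (auto simp: M_def)
      then have "real_of_int \<bar>offset S T k l i\<bar> * real (M i) * Ts
          \<le> (real K + real L) * (2 * (real N - 1)) * real M\<^sub>m\<^sub>a\<^sub>x * Ts"
        using Ts by (intro mult_right_mono) auto
      then show "of_int \<bar>offset S T k l i\<bar> * real (M i) * Ts
          \<le> 2 * (real N - 1) * (real K + real L) * real M\<^sub>m\<^sub>a\<^sub>x * Ts"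
        by (simp only: mult_ac)
    qed (use KL in \<open>auto simp: sel intro: finite_subset[OF T[unfolded sel]]\<close>)
    have count: "real (size (virtual_samples y S L k))
        \<ge> real L * (1 / pi\<^sup>2) * real N * (real N - 1) * (real N - 2)" for y k
      using mult_left_mono[OF elim(1), of "real L"] size_virtual_samples[OF S nz, of y k]
      by (simp add: sel mult_ac)
    show "\<exists>M S. (\<forall>i\<in>{1..N}. 0 < M i) \<and> Max (M ` {1..N}) = M\<^sub>m\<^sub>a\<^sub>x \<and>
        coprime_scheme N M K L S \<and>
        (\<forall>D A \<omega> \<phi> w. \<forall>k\<in>{1..K}.
          real (size (virtual_samples (sampler_output (waveform D A \<omega> \<phi>) w M Ts) S L k))
            \<ge> real L * (1 / pi\<^sup>2) * real N * (real N - 1) * (real N - 2)) \<and>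
        time_delay M Ts K L S
          \<le> 2 * (real N - 1) * (real K + real L) * real (Max (M ` {1..N})) * Ts"
    proof (rule exI[of _ M], rule exI[of _ S], intro conjI)
      show "\<forall>i\<in>{1..N}. 0 < M i"
        by (simp add: M_def)
    qed (use Max S count delay in \<open>simp_all only: Max Ball_def simp_thms\<close>)
  qed
qed

end
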